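(* For the $x$-splitting system of the modified special relativistic magnetohydrodynamics (RMHD) equations $$\frac{\partial \mathbf U}{\partial t}+\frac{\partial \mathbf F_1(\mathbf U)}{\partial x}=-\Phi'(\mathbf V)^{\mathrm T}\frac{\partial B_1}{\partial x},$$ with the entropy pair $(\eta,q_1)$ given in the context, the two-point flux $\mathbf F_1^{EC}(\mathbf U_L,\mathbf U_R)=(F_1,F_2,\dots,F_8)^{\mathrm T}$ defined below is entropy conservative and consistent with the physical flux $\mathbf F_1$. That is, $\mathbf F_1^{EC}$ satisfies, for all admissible states $\mathbf U_L,\mathbf U_R,\mathbf U$: (i) (consistency) $\mathbf F_1^{EC}(\mathbf U,\mathbf U)=\mathbf F_1(\mathbf U)$; (ii) (symmetry) $\mathbf F_1^{EC}(\mathbf U_L,\mathbf U_R)=\mathbf F_1^{EC}(\mathbf U_R,\mathbf U_L)$; (iii) $[\![\mathbf V]\!]^{\mathrm T}\,\mathbf F_1^{EC}(\mathbf U_L,\mathbf U_R)=[\![\psi_1]\!]-[\![\Phi]\!]\,\overline{B_1}$. The components of the flux are $$F_1=\rho^{\ln}\,\overline{u^x},\qquad F_6=0,$$ $$F_7=\frac{\overline{\beta u^x}\;\overline{b^y}}{\overline\beta}-\frac{\overline{Wb^x}\;\overline{\beta u^y}}{\overline W\,\overline\beta},\qquad F_8=\frac{\overline{\beta u^x}\;\overline{b^z}}{\overline\beta}-\frac{\overline{Wb^x}\;\overline{\beta u^z}}{\overline W\,\overline\beta},$$ $$F_5=\mathcal D^{-1}\left[\overline{u^x}\,R_2+\overline{u^y}\,R_3+\overline{u^z}\,R_4-\overline\beta\,R_1\right],\qquad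 \mathcal D=\frac{\overline\beta\left(\overline W^{\,2}-\overline{u^x}^{\,2}-\overline{u^y}^{\,2}-\overline{u^z}^{\,2}\right)}{\overline W},$$ $$F_2=\frac{\overline{u^x}F_5}{\overline W}+\frac{R_2}{\overline\beta},\qquad F_3=\frac{\overline{u^y}F_5}{\overline W}+\frac{R_3}{\overline\beta},\qquad F_4=\frac{\overline{u^z}F_5}{\overline W}+\frac{R_4}{\overline\beta},$$ where $$\alpha_0=1+\frac{1}{(\Gamma-1)\beta^{\ln}},\qquad \alpha_1=\frac{b^x_Lb^x_RW_LW_R}{2\,\overline{W^2}},\qquad \tau=\Big(\sum_{m\in\{x,y,z\}}b^m_Lu^m_L\Big)\Big(\sum_{l\in\{x,y,z\}}b^l_Ru^l_R\Big)\frac{\beta_L\beta_R}{2W_LW_R\overline\beta},$$ $$\begin{aligned} R_1={}&-\alpha_0F_1-\alpha_1\overline{u^x}+\tfrac12\left(\overline{(b^y)^2}+\overline{(b^z)^2}\right)\overline{u^x}-\frac{\overline{Wb^x}}{\overline W}\left(\overline{b^y}\,\overline{u^y}+\overline{b^z}\,\overline{u^z}\right)+\tau\,\overline{\left(\frac{u^x}{\beta}\right)}-\overline{b^y}F_7-\overline{b^z}F_8,\\ R_2={}&\overline\rho-\alpha_1\overline\beta+2\alpha_1\overline{\left(\frac{\beta u^x}{W^2}\right)}\,\overline{u^x}+\tfrac12\left(\overline{(b^y)^2}+\overline{(b^z)^2}\right)\overline\beta+\frac{\overline{Wb^x}}{\overline W}\left(\overline{\left(\frac{\beta u^yb^y}{W}\right)}+\overline{\left(\frac{\beta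 u^zb^z}{W}\right)}\right)\frac{\overline{u^x}}{\overline W}-\tau,\\ R_3={}&2\alpha_1\overline{\left(\frac{\beta u^x}{W^2}\right)}\,\overline{u^y}-\frac{\overline{Wb^x}}{\overline W}\left(\overline\beta\,\overline{b^y}-\overline{\left(\frac{\beta u^yb^y}{W}\right)}\frac{\overline{u^y}}{\overline W}-\overline{\left(\frac{\beta u^zb^z}{W}\right)}\frac{\overline{u^y}}{\overline W}\right),\\ R_4={}&2\alpha_1\overline{\left(\frac{\beta u^x}{W^2}\right)}\,\overline{u^z}-\frac{\overline{Wb^x}}{\overline W}\left(\overline\beta\,\overline{b^z}-\overline{\left(\frac{\beta u^yb^y}{W}\right)}\frac{\overline{u^z}}{\overline W}-\overline{\left(\frac{\beta u^zb^z}{W}\right)}\frac{\overline{u^z}}{\overline W}\right). \end{aligned}$$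
   Context: **Physical variables.** The speed of light is $1$ and the adiabatic index is a fixed $\Gamma\in(1,2]$. A state is described by primitive variables $(\rho,\mathbf v,p,\mathbf B)$ with rest-mass density $\rho>0$, velocity $\mathbf v=(v_1,v_2,v_3)\in\mathbb R^3$ with $|\mathbf v|<1$, gas pressure $p>0$ and magnetic field $\mathbf B=(B_1,B_2,B_3)\in\mathbb R^3$ (such states are called admissible here). Set $$W=\frac1{\sqrt{1-|\mathbf v|^2}},\qquad (u^x,u^y,u^z)=W\mathbf v,\qquad (b^x,b^y,b^z)=\frac{\mathbf B}{W}+W(\mathbf v\cdot\mathbf B)\mathbf v,$$ $$|b|^2=\frac{|\mathbf B|^2}{W^2}+(\mathbf v\cdot\mathbf B)^2,\qquad p_{\rm tot}=p+\tfrac12|b|^2,\qquad \beta=\frac{\rho}{p}.$$ The equation of state is $p=(\Gamma-1)\rho\epsilon$, the total energy density is $e=\rho(1+\epsilon)$, and the specific enthalpy is $h=(e+p)/\rho$, i.e. $h=1+\frac{\Gamma}{\Gamma-1}\frac{p}{\rho}$. **Conservative variables and flux.** $\mathbf U=(D,\mathbf m,E,\mathbf B)^{\mathrm T}\in\mathbb R^8$ with $$D=\rho W,\qquad \mathbf m=(m_1,m_2,m_3)=(\rho hW^2+|\mathbf B|^2)\mathbf v-(\mathbf v\cdot\mathbf B)\mathbf B,\qquad E=DhW-p_{\rm tot}+|\mathbf B|^2,$$ and $$\mathbf F_1(\mathbf U)=\Big(Dv_1,\ \mathbf m v_1-B_1\big(\mathbf B/W^2+(\mathbf v\cdot\mathbf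 B)\mathbf v\big)+p_{\rm tot}\mathbf e_1,\ m_1,\ v_1\mathbf B-B_1\mathbf v\Big)^{\mathrm T},\qquad \mathbf e_1=(1,0,0).$$ All functions of $\mathbf U$ are evaluated through the primitive variables corresponding to $\mathbf U$. **Entropy pair, entropy variables, potential.** With $s=\ln p-\Gamma\ln\rho$, the entropy pair is $\eta=-\frac{\rho Ws}{\Gamma-1}$, $q_1=-\frac{\rho v_1Ws}{\Gamma-1}$. The entropy variables $\mathbf V=\eta'(\mathbf U)^{\mathrm T}=(V_1,\dots,V_8)^{\mathrm T}$ are explicitly $$\mathbf V=\left(\frac{\Gamma-s}{\Gamma-1}+\frac{\rho}{p},\ \frac{\rho u^x}{p},\ \frac{\rho u^y}{p},\ \frac{\rho u^z}{p},\ -\frac{\rho W}{p},\ \frac{\rho b^x}{p},\ \frac{\rho b^y}{p},\ \frac{\rho b^z}{p}\right)^{\mathrm T}.$$ The function $\Phi$ is $$\Phi(\mathbf V)=-\frac{V_2V_6+V_3V_7+V_4V_8}{V_5}=\frac{\rho W(\mathbf v\cdot\mathbf B)}{p},$$ and the entropy potential is $$\psi_1=\mathbf V^{\mathrm T}\mathbf F_1(\mathbf U)+\Phi(\mathbf V)B_1-q_1(\mathbf U)=\rho v_1W+\frac{\rho v_1W|b|^2}{2p}.$$ **Two-point notation.** For two admissible states $\mathbf U_L,\mathbf U_R$ and a quantity $a$ with values $a_L,a_R$ at these states: $[\![a]\!]=a_R-a_L$ (jump); $\overline a=\frac12(a_L+a_R)$ (arithmetic mean; the mean of a product or quotient is the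 mean of the whole expression, e.g. $\overline{\beta u^x}=\frac12(\beta_Lu^x_L+\beta_Ru^x_R)$, while $\overline W^{\,2}$ is the square of $\overline W$); and for $a>0$, $a^{\ln}=[\![a]\!]/[\![\ln a]\!]$ (logarithmic mean), with $a^{\ln}=a_L$ when $a_L=a_R$. **Definition.** For the given entropy pair, a two-point numerical flux $\tilde{\mathbf F}_1(\mathbf U_L,\mathbf U_R)$ is *consistent* with $\mathbf F_1$ if $\tilde{\mathbf F}_1(\mathbf U,\mathbf U)=\mathbf F_1(\mathbf U)$, and is called *entropy conservative* if it is consistent, symmetric in its two arguments, and satisfies $[\![\mathbf V]\!]^{\mathrm T}\tilde{\mathbf F}_1=[\![\psi_1]\!]-[\![\Phi]\!]\,\overline{B_1}$. *)

theory Defs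
  imports "HOL-Analysis.Analysis"
begin

section \<open>Vectors with eight components\<close>

text \<open>
  In the index type \<open>8\<close> the numeral \<open>8\<close> denotes the same element as \<open>0\<close>, so that
  the components \<open>1, \<dots>, 8\<close> are exactly the components of a vector in \<open>real ^ 8\<close>.
\<close>

lemma exhaust_8:
  fixes x :: 8
  shows "x = 1 \<or> x = 2 \<or> x = 3 \<or> x = 4 \<or> x = 5 \<or> x = 6 \<or> x = 7 \<or> x = 8"
proof (induct x)
  case (of_int z)
  then have "z = 0 \<or> z = 1 \<or> z = 2 \<or> z = 3 \<or> z = 4 \<or> z = 5 \<or> z = 6 \<or> z = 7"
    by auto
  then show ?case by auto
qed

lemma forall_8:
  "(\<forall>i::8. P i) \<longleftrightarrow> P 1 \<and> P 2 \<and> P 3 \<and> P 4 \<and> P 5 \<and> P 6 \<and> P 7 \<and> P 8"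
  by (metis exhaust_8)

lemma UNIV_8: "UNIV = {1, 2, 3, 4, 5, 6, 7, 8 :: 8}"
  using exhaust_8 by auto

lemma sum_8: "sum f (UNIV :: 8 set) = f 1 + f 2 + f 3 + f 4 + f 5 + f 6 + f 7 + f 8"
  unfolding UNIV_8 by (simp add: ac_simps)

lemma vector_8:
  fixes a1 :: "'a::zero"
  shows "(vector [a1, a2, a3, a4, a5, a6, a7, a8] :: 'a ^ 8) $ 1 = a1"
    and "(vector [a1, a2, a3, a4, a5, a6, a7, a8] :: 'a ^ 8) $ 2 = a2"
    and "(vector [a1, a2, a3, a4, a5, a6, a7, a8] :: 'a ^ 8) $ 3 = a3"
    and "(vector [a1, a2, a3, a4, a5, a6, a7, a8] :: 'a ^ 8) $ 4 = a4"
    and "(vector [a1, a2, a3, a4, a5, a6, a7, a8] :: 'a ^ 8) $ 5 = a5"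
    and "(vector [a1, a2, a3, a4, a5, a6, a7, a8] :: 'a ^ 8) $ 6 = a6"
    and "(vector [a1, a2, a3, a4, a5, a6, a7, a8] :: 'a ^ 8) $ 7 = a7"
    and "(vector [a1, a2, a3, a4, a5, a6, a7, a8] :: 'a ^ 8) $ 8 = a8"
  unfolding vector_def by simp_all

section \<open>States\<close>

text \<open>
  A state is given by its primitive variables \<open>(\<rho>, v, p, B)\<close>, and every function of the
  conservative variables \<open>U\<close> is evaluated through them: in particular \<open>F\<^sub>1(U)\<close> and the two-point
  fluxes \<open>F(U\<^sub>L, U\<^sub>R)\<close> are functions of states.  The speed of light is 1, the adiabatic index
  \<open>\<Gamma>\<close> is an explicit parameter \<open>G\<close>.
\<close>

record state =
  rho :: real          \<comment> \<open>rest-mass density\<close>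
  vel :: "real ^ 3"
  prs :: real          \<comment> \<open>gas pressure\<close>
  mag :: "real ^ 3"    \<comment> \<open>magnetic field\<close>

definition admissible :: "state \<Rightarrow> bool" where
  "admissible w \<longleftrightarrow> rho w > 0 \<and> prs w > 0 \<and> norm (vel w) < 1"

definition lorentz :: "state \<Rightarrow> real" where
  "lorentz w = 1 / sqrt (1 - (norm (vel w))\<^sup>2)"

definition uvec :: "state \<Rightarrow> real ^ 3" where
  "uvec w = lorentz w *\<^sub>R vel w"

definition bvec :: "state \<Rightarrow> real ^ 3" where
  "bvec w = (1 / lorentz w) *\<^sub>R mag w + (lorentz w * (vel w \<bullet> mag w)) *\<^sub>R vel w"

text \<open>
  The Lorentz invariant \<open>|b|\<^sup>2\<close>, which is not the Euclidean norm of the spatial part \<open>bvec\<close>.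
\<close>

definition bsq :: "state \<Rightarrow> real" where
  "bsq w = (norm (mag w))\<^sup>2 / (lorentz w)\<^sup>2 + (vel w \<bullet> mag w)\<^sup>2"

definition ptot :: "state \<Rightarrow> real" where
  "ptot w = prs w + bsq w / 2"

definition beta :: "state \<Rightarrow> real" where
  "beta w = rho w / prs w"

text \<open>The specific internal energy \<open>\<epsilon>\<close>, from the equation of state \<open>p = (\<Gamma> - 1) \<rho> \<epsilon>\<close>.\<close>

definition int_energy :: "real \<Rightarrow> state \<Rightarrow> real" where
  "int_energy G w = prs w / ((G - 1) * rho w)"

definition energy_density :: "real \<Rightarrow> state \<Rightarrow> real" where
  "energy_density G w = rho w * (1 + int_energy G w)"

definition enthalpy :: "real \<Rightarrow> state \<Rightarrow> real" where
  "enthalpy G w = (energy_density G w + prs w) / rho w"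

lemma enthalpy_eq:
  assumes "1 < G" "admissible w"
  shows "enthalpy G w = 1 + G / (G - 1) * (prs w / rho w)"
  using assms
  by (simp add: enthalpy_def energy_density_def int_energy_def admissible_def field_simps)

section \<open>Conservative variables and physical flux\<close>

definition cons_D :: "state \<Rightarrow> real" where
  "cons_D w = rho w * lorentz w"

definition cons_m :: "real \<Rightarrow> state \<Rightarrow> real ^ 3" where
  "cons_m G w =
     (rho w * enthalpy G w * (lorentz w)\<^sup>2 + (norm (mag w))\<^sup>2) *\<^sub>R vel w
     - (vel w \<bullet> mag w) *\<^sub>R mag w"

definition cons_E :: "real \<Rightarrow> state \<Rightarrow> real" where
  "cons_E G w = cons_D w * enthalpy G w * lorentz w - ptot w + (norm (mag w))\<^sup>2"

definition conservative :: "real \<Rightarrow> state \<Rightarrow> real ^ 8" where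
  "conservative G w = vector
     [cons_D w,
      cons_m G w $ 1, cons_m G w $ 2, cons_m G w $ 3,
      cons_E G w,
      mag w $ 1, mag w $ 2, mag w $ 3]"

definition flux_m :: "real \<Rightarrow> state \<Rightarrow> real ^ 3" where
  "flux_m G w =
     (vel w $ 1) *\<^sub>R cons_m G w
     - (mag w $ 1) *\<^sub>R ((1 / (lorentz w)\<^sup>2) *\<^sub>R mag w + (vel w \<bullet> mag w) *\<^sub>R vel w)
     + ptot w *\<^sub>R axis 1 1"

definition flux_B :: "state \<Rightarrow> real ^ 3" where
  "flux_B w = (vel w $ 1) *\<^sub>R mag w - (mag w $ 1) *\<^sub>R vel w"

definition phys_flux :: "real \<Rightarrow> state \<Rightarrow> real ^ 8" where
  "phys_flux G w = vector
     [cons_D w * vel w $ 1,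
      flux_m G w $ 1, flux_m G w $ 2, flux_m G w $ 3,
      cons_m G w $ 1,
      flux_B w $ 1, flux_B w $ 2, flux_B w $ 3]"

section \<open>Entropy pair, entropy variables, entropy potential\<close>

definition spec_entropy :: "real \<Rightarrow> state \<Rightarrow> real" where
  "spec_entropy G w = ln (prs w) - G * ln (rho w)"

definition eta :: "real \<Rightarrow> state \<Rightarrow> real" where
  "eta G w = - (rho w * lorentz w * spec_entropy G w) / (G - 1)"

definition q1 :: "real \<Rightarrow> state \<Rightarrow> real" where
  "q1 G w = - (rho w * vel w $ 1 * lorentz w * spec_entropy G w) / (G - 1)"

text \<open>
  The entropy variables \<open>V = \<eta>'(U)\<close> in their explicit form; lemma \<open>eta_chain_rule\<close> below
  confirms \<open>d\<eta> = V \<bullet> dU\<close>.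
\<close>

definition entropy_vars :: "real \<Rightarrow> state \<Rightarrow> real ^ 8" where
  "entropy_vars G w = vector
     [(G - spec_entropy G w) / (G - 1) + rho w / prs w,
      rho w * uvec w $ 1 / prs w, rho w * uvec w $ 2 / prs w, rho w * uvec w $ 3 / prs w,
      - (rho w * lorentz w / prs w),
      rho w * bvec w $ 1 / prs w, rho w * bvec w $ 2 / prs w, rho w * bvec w $ 3 / prs w]"

definition Phi :: "real ^ 8 \<Rightarrow> real" where
  "Phi V = - ((V $ 2 * V $ 6 + V $ 3 * V $ 7 + V $ 4 * V $ 8) / V $ 5)"

lemma Phi_eq:
  assumes "admissible w"
  shows "Phi (entropy_vars G w) = rho w * lorentz w * (vel w \<bullet> mag w) / prs w"
proof -
  define a where "a = vel w \<bullet> vel w"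
  define k where "k = vel w \<bullet> mag w"
  define W where "W = lorentz w"
  have a1: "a < 1"
    using assms by (simp add: a_def admissible_def dot_square_norm abs_square_less_1)
  have W: "W = 1 / sqrt (1 - a)"
    by (simp add: W_def lorentz_def a_def dot_square_norm)
  have W0: "W > 0" using a1 by (simp add: W)
  have aW: "a = 1 - 1 / W\<^sup>2" using a1 by (simp add: W power_divide)
  have pos: "rho w > 0" "prs w > 0" using assms by (auto simp: admissible_def)
  have "uvec w \<bullet> bvec w = k + W\<^sup>2 * k * a"
    using W0 by (simp add: uvec_def bvec_def inner_add_right a_def k_def W_def power2_eq_square)
  also have "\<dots> = W\<^sup>2 * k"
    using W0 by (simp add: aW field_simps)
  finally have ub: "uvec w $ 1 * bvec w $ 1 + uvec w $ 2 * bvec w $ 2 + uvec w $ 3 * bvec w $ 3 = W\<^sup>2 * k"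
    by (simp add: inner_vec_def sum_3)
  have "Phi (entropy_vars G w) =
     rho w / (prs w * W) * (uvec w $ 1 * bvec w $ 1 + uvec w $ 2 * bvec w $ 2 + uvec w $ 3 * bvec w $ 3)"
    using pos W0 by (simp add: Phi_def entropy_vars_def vector_8 W_def field_simps)
  then show ?thesis
    unfolding ub using W0 pos by (simp add: W_def k_def power2_eq_square)
qed

definition psi1 :: "real \<Rightarrow> state \<Rightarrow> real" where
  "psi1 G w =
     entropy_vars G w \<bullet> phys_flux G w + Phi (entropy_vars G w) * mag w $ 1 - q1 G w"

lemma has_vector_derivative_vec_nth:
  fixes f :: "real \<Rightarrow> real ^ 'n"
  shows "(f has_vector_derivative f') (at t) \<longleftrightarrow>
    (\<forall>i. ((\<lambda>s. f s $ i) has_real_derivative f' $ i) (at t))"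
  unfolding has_vector_derivative_def has_field_derivative_def
  by (subst has_derivative_componentwise_within)
     (auto simp: Basis_vec_def inner_axis mult_commute_abs)

text \<open>
  Along every differentiable curve of admissible states, the entropy changes at the rate
  \<open>V \<bullet> dU/dt\<close>.
\<close>

lemma eta_chain_rule:
  fixes w :: "real \<Rightarrow> state"
  assumes G: "1 < G" and adm: "\<And>s. admissible (w s)"
    and d: "((\<lambda>s. rho (w s)) has_real_derivative r') (at t)"
      "((\<lambda>s. vel (w s)) has_vector_derivative v') (at t)"
      "((\<lambda>s. prs (w s)) has_real_derivative p') (at t)"
      "((\<lambda>s. mag (w s)) has_vector_derivative B') (at t)"
  shows "\<exists>U'. ((\<lambda>s. conservative G (w s)) has_vector_derivative U') (at t) \<and>
    ((\<lambda>s. eta G (w s)) has_real_derivative entropy_vars G (w t) \<bullet> U') (at t)"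
proof -
  define r where "r = (\<lambda>s. rho (w s))"
  define p where "p = (\<lambda>s. prs (w s))"
  define v where "v = (\<lambda>s. vel (w s))"
  define B where "B = (\<lambda>s. mag (w s))"
  define W where "W = (\<lambda>s. lorentz (w s))"
  define k where "k = (\<lambda>s. v s \<bullet> B s)"
  define b where "b = (\<lambda>s. B s \<bullet> B s)"
  define g where "g = G / (G - 1)"
  define Q where "Q = (\<lambda>s. (r s + g * p s) * (W s)\<^sup>2)"
  note d' = d[folded r_def v_def p_def B_def]
  have pos: "r s > 0" "p s > 0" for s
    using adm[of s] by (auto simp: admissible_def r_def p_def)
  have a1: "v s \<bullet> v s < 1" for s
    using adm[of s] by (simp add: v_def admissible_def dot_square_norm abs_square_less_1)
  have W: "W s = 1 / sqrt (1 - v s \<bullet> v s)" for s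
    by (simp add: W_def lorentz_def v_def dot_square_norm)
  have W0: "W s > 0" for s using a1[of s] by (simp add: W)
  have aW: "v s \<bullet> v s = 1 - 1 / (W s)\<^sup>2" for s
    using a1[of s] by (simp add: W power_divide)
  have din: "((\<lambda>s. f s \<bullet> h s) has_real_derivative f t \<bullet> h' + f' \<bullet> h t) (at t)"
    if "(f has_vector_derivative f') (at t)" "(h has_vector_derivative h') (at t)"
    for f h :: "real \<Rightarrow> real ^ 3" and f' h'
    using bounded_bilinear.has_vector_derivative[OF bounded_bilinear_inner that]
    by (simp add: has_real_derivative_iff_has_vector_derivative)
  define x where "x = v t \<bullet> v'"
  define y where "y = v t \<bullet> B'"
  define z where "z = v' \<bullet> B t"
  define c where "c = B t \<bullet> B'"
  define W' where "W' = (W t) ^ 3 * x"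
  have da: "((\<lambda>s. v s \<bullet> v s) has_real_derivative 2 * x) (at t)"
    using din[OF d'(2) d'(2)] by (simp add: x_def inner_commute)
  have dk: "(k has_real_derivative y + z) (at t)"
    using din[OF d'(2) d'(4)] by (simp add: k_def y_def z_def)
  have db: "(b has_real_derivative 2 * c) (at t)"
    using din[OF d'(4) d'(4)] by (simp add: b_def c_def inner_commute)
  have dW: "(W has_real_derivative W') (at t)"
  proof -
    define q where "q = sqrt (1 - v t \<bullet> v t)"
    have q0: "q > 0" using a1[of t] by (simp add: q_def)
    have d1: "((\<lambda>s. 1 - v s \<bullet> v s) has_real_derivative - (2 * x)) (at t)"
      using DERIV_diff[OF DERIV_const[of 1] da] by simp
    have d2: "((\<lambda>s. sqrt (1 - v s \<bullet> v s)) has_real_derivative inverse q / 2 * (- (2 * x))) (at t)"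
      using DERIV_chain2[OF DERIV_real_sqrt d1] a1[of t] by (simp add: q_def)
    have d3: "((\<lambda>s. inverse (sqrt (1 - v s \<bullet> v s))) has_real_derivative
        - (inverse q * (inverse q / 2 * (- (2 * x))) * inverse q)) (at t)"
      using DERIV_inverse'[OF d2] q0 by (simp add: q_def)
    have "- (inverse q * (inverse q / 2 * (- (2 * x))) * inverse q) = W'"
      by (simp add: W'_def W q_def power3_eq_cube field_simps)
    moreover have "W = (\<lambda>s. inverse (sqrt (1 - v s \<bullet> v s)))"
      by (rule ext) (simp add: W inverse_eq_divide)
    ultimately show ?thesis using d3 by simp
  qed
  define Q' where "Q' = (r' + g * p') * (W t)\<^sup>2 + (r t + g * p t) * (2 * W t * W')"
  have dQ: "(Q has_real_derivative Q') (at t)"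
    unfolding Q_def Q'_def
    by (auto intro!: derivative_eq_intros d' dW)
  have Bnth: "((\<lambda>s. B s $ i) has_real_derivative B' $ i) (at t)"
    and vnth: "((\<lambda>s. v s $ i) has_real_derivative v' $ i) (at t)" for i
    using d'(2,4) unfolding has_vector_derivative_vec_nth by auto
  have h: "rho (w s) * enthalpy G (w s) = r s + g * p s" for s
    using pos[of s] by (simp add: enthalpy_eq[OF G adm] r_def p_def g_def distrib_left)
  have m: "cons_m G (w s) $ i = (Q s + b s) * v s $ i - k s * B s $ i" for s i
    unfolding cons_m_def h
    by (simp add: Q_def b_def k_def v_def B_def W_def dot_square_norm)
  have E: "cons_E G (w s) = Q s - (p s + (b s / (W s)\<^sup>2 + (k s)\<^sup>2) / 2) + b s" for s
  proof -
    have "cons_E G (w s) = rho (w s) * enthalpy G (w s) * (lorentz (w s))\<^sup>2 - ptot (w s) + (norm (mag (w s)))\<^sup>2"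
      by (simp add: cons_E_def cons_D_def power2_eq_square)
    then show ?thesis
      unfolding h by (simp add: Q_def ptot_def bsq_def p_def b_def k_def v_def B_def W_def dot_square_norm)
  qed
  define D' where "D' = r' * W t + r t * W'"
  define m' where "m' = (Q' + 2 * c) *\<^sub>R v t + (Q t + b t) *\<^sub>R v' - (y + z) *\<^sub>R B t - k t *\<^sub>R B'"
  define E' where "E' = Q' - (p' + (2 * c / (W t)\<^sup>2 - 2 * b t * W' / (W t) ^ 3 + 2 * k t * (y + z)) / 2) + 2 * c"
  define U' :: "real ^ 8" where "U' = vector [D', m' $ 1, m' $ 2, m' $ 3, E', B' $ 1, B' $ 2, B' $ 3]"
  have dD: "((\<lambda>s. cons_D (w s)) has_real_derivative D') (at t)"
  proof -
    have "((\<lambda>s. r s * W s) has_real_derivative D') (at t)"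
      unfolding D'_def by (auto intro!: derivative_eq_intros d' dW)
    then show ?thesis by (simp add: cons_D_def r_def W_def)
  qed
  have dm: "((\<lambda>s. cons_m G (w s) $ i) has_real_derivative m' $ i) (at t)" for i
    unfolding m m'_def
    by (auto intro!: derivative_eq_intros dQ db dk vnth Bnth simp: algebra_simps)
  have dE: "((\<lambda>s. cons_E G (w s)) has_real_derivative E') (at t)"
    unfolding E E'_def
    using W0[of t]
    by (auto intro!: derivative_eq_intros dQ db dk dW d' simp: field_simps power2_eq_square power3_eq_cube)
  have "((\<lambda>s. conservative G (w s)) has_vector_derivative U') (at t)"
    unfolding has_vector_derivative_vec_nth forall_8
    using dD dm dE Bnth by (simp add: conservative_def U'_def vector_8 B_def)
  moreover
  define S where "S = spec_entropy G (w t)"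
  have V: "entropy_vars G (w t) \<bullet> U' =
    ((G - S) / (G - 1) + r t / p t) * D'
    + r t / p t * (uvec (w t) \<bullet> m' - W t * E' + bvec (w t) \<bullet> B')"
    by (simp add: inner_vec_def sum_8 sum_3 U'_def entropy_vars_def vector_8 S_def r_def p_def
        W_def algebra_simps add_divide_distrib)
  have um: "uvec (w t) \<bullet> m' =
    W t * ((Q' + 2 * c) * (1 - 1 / (W t)\<^sup>2) + (Q t + b t) * x - (y + z) * k t - k t * y)"
    by (simp add: uvec_def m'_def inner_diff_right inner_add_right flip: W_def v_def aW)
       (simp add: x_def y_def k_def v_def W_def algebra_simps)
  have bB: "bvec (w t) \<bullet> B' = c / W t + W t * k t * y"
    by (simp add: bvec_def inner_add_left c_def y_def k_def v_def B_def W_def)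
  have key: "uvec (w t) \<bullet> m' - W t * E' + bvec (w t) \<bullet> B' =
      - r t * W' - r' * W t - g * (p t * W' + p' * W t) + W t * p' "
  proof -
    have 1: "(1 - 1 / (W t)\<^sup>2) * W t = W t - 1 / W t" "c / (W t)\<^sup>2 * W t = c / W t"
      "W' / (W t) ^ 3 * W t = W t * x"
      using W0[of t] by (simp_all add: field_simps power2_eq_square power3_eq_cube W'_def)
    have "uvec (w t) \<bullet> m' - W t * E' + bvec (w t) \<bullet> B' =
      (Q' + 2 * c) * ((1 - 1 / (W t)\<^sup>2) * W t) + W t * (Q t + b t) * x - W t * (y + z) * k t
      - W t * k t * y - W t * Q'
      + c / (W t)\<^sup>2 * W t - b t * (W' / (W t) ^ 3 * W t) + W t * k t * (y + z) + W t * p'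
      - W t * 2 * c + c / W t + W t * k t * y"
      unfolding um bB E'_def by (simp add: algebra_simps add_divide_distrib diff_divide_distrib)
    also have "\<dots> = W t * Q t * x - Q' / W t + W t * p'"
      unfolding 1 by (simp add: algebra_simps add_divide_distrib)
    also have "Q' / W t = (r' + g * p') * W t + 2 * (r t + g * p t) * W'"
      using W0[of t] by (simp add: Q'_def field_simps power2_eq_square)
    also have "W t * Q t * x = (r t + g * p t) * W'"
      by (simp add: Q_def W'_def power2_eq_square power3_eq_cube)
    finally show ?thesis by (simp add: algebra_simps)
  qed
  have "((\<lambda>s. eta G (w s)) has_real_derivative
     - (D' * S + r t * W t * (p' / p t - G * (r' / r t))) / (G - 1)) (at t)"
  proof -
    have lnd: "((\<lambda>s. ln (p s) - G * ln (r s)) has_real_derivative p' / p t - G * (r' / r t)) (at t)"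
      using pos[of t] by (auto intro!: derivative_eq_intros d')
    have rW: "((\<lambda>s. r s * W s) has_real_derivative D') (at t)"
      using dD by (simp add: cons_D_def r_def W_def)
    have "((\<lambda>s. - (r s * W s * (ln (p s) - G * ln (r s))) / (G - 1)) has_real_derivative
       - (D' * S + r t * W t * (p' / p t - G * (r' / r t))) / (G - 1)) (at t)"
      using DERIV_cdivide[OF DERIV_minus[OF DERIV_mult[OF rW lnd]], of "G - 1"]
      by (simp add: S_def spec_entropy_def r_def p_def algebra_simps)
    then show ?thesis by (simp add: eta_def spec_entropy_def r_def p_def W_def)
  qed
  moreover have "- (D' * S + r t * W t * (p' / p t - G * (r' / r t))) / (G - 1) = entropy_vars G (w t) \<bullet> U'"
  proof -
    define H where "H = G - 1"
    have H: "G = H + 1" "H > 0" using G by (simp_all add: H_def)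
    show ?thesis
      unfolding V key D'_def g_def using pos[of t] H(2) by (simp add: H(1) field_simps)
  qed
  ultimately show ?thesis by auto
qed

section \<open>Two-point operators and entropy conservative fluxes\<close>

definition jump :: "(state \<Rightarrow> 'a::real_vector) \<Rightarrow> state \<Rightarrow> state \<Rightarrow> 'a" where
  "jump a L R = a R - a L"

definition avg :: "(state \<Rightarrow> real) \<Rightarrow> state \<Rightarrow> state \<Rightarrow> real" where
  "avg a L R = (a L + a R) / 2"

definition log_mean :: "(state \<Rightarrow> real) \<Rightarrow> state \<Rightarrow> state \<Rightarrow> real" where
  "log_mean a L R = (if a L = a R then a L else jump a L R / jump (\<lambda>w. ln (a w)) L R)"

definition consistent_flux :: "real \<Rightarrow> (state \<Rightarrow> state \<Rightarrow> real ^ 8) \<Rightarrow> bool" where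
  "consistent_flux G F \<longleftrightarrow> (\<forall>w. admissible w \<longrightarrow> F w w = phys_flux G w)"

definition entropy_conservative :: "real \<Rightarrow> (state \<Rightarrow> state \<Rightarrow> real ^ 8) \<Rightarrow> bool" where
  "entropy_conservative G F \<longleftrightarrow>
     consistent_flux G F \<and>
     (\<forall>L R. admissible L \<longrightarrow> admissible R \<longrightarrow> F L R = F R L) \<and>
     (\<forall>L R. admissible L \<longrightarrow> admissible R \<longrightarrow>
        jump (entropy_vars G) L R \<bullet> F L R =
          jump (psi1 G) L R
          - jump (\<lambda>w. Phi (entropy_vars G w)) L R * avg (\<lambda>w. mag w $ 1) L R)"

section \<open>The two-point flux\<close>

abbreviation "u_x w \<equiv> uvec w $ 1"
abbreviation "u_y w \<equiv> uvec w $ 2"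
abbreviation "u_z w \<equiv> uvec w $ 3"
abbreviation "b_x w \<equiv> bvec w $ 1"
abbreviation "b_y w \<equiv> bvec w $ 2"
abbreviation "b_z w \<equiv> bvec w $ 3"

definition alpha0 :: "real \<Rightarrow> state \<Rightarrow> state \<Rightarrow> real" where
  "alpha0 G L R = 1 + 1 / ((G - 1) * log_mean beta L R)"

definition alpha1 :: "state \<Rightarrow> state \<Rightarrow> real" where
  "alpha1 L R = b_x L * b_x R * lorentz L * lorentz R / (2 * avg (\<lambda>w. (lorentz w)\<^sup>2) L R)"

definition tau :: "state \<Rightarrow> state \<Rightarrow> real" where
  "tau L R =
     (bvec L \<bullet> uvec L) * (bvec R \<bullet> uvec R)
     * (beta L * beta R / (2 * lorentz L * lorentz R * avg beta L R))"

definition ec_F1 :: "state \<Rightarrow> state \<Rightarrow> real" where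
  "ec_F1 L R = log_mean rho L R * avg u_x L R"

definition ec_F7 :: "state \<Rightarrow> state \<Rightarrow> real" where
  "ec_F7 L R =
     avg (\<lambda>w. beta w * u_x w) L R * avg b_y L R / avg beta L R
     - avg (\<lambda>w. lorentz w * b_x w) L R * avg (\<lambda>w. beta w * u_y w) L R
         / (avg lorentz L R * avg beta L R)"

definition ec_F8 :: "state \<Rightarrow> state \<Rightarrow> real" where
  "ec_F8 L R =
     avg (\<lambda>w. beta w * u_x w) L R * avg b_z L R / avg beta L R
     - avg (\<lambda>w. lorentz w * b_x w) L R * avg (\<lambda>w. beta w * u_z w) L R
         / (avg lorentz L R * avg beta L R)"

definition ec_R1 :: "real \<Rightarrow> state \<Rightarrow> state \<Rightarrow> real" where
  "ec_R1 G L R =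
     - alpha0 G L R * ec_F1 L R
     - alpha1 L R * avg u_x L R
     + 1/2 * (avg (\<lambda>w. (b_y w)\<^sup>2) L R + avg (\<lambda>w. (b_z w)\<^sup>2) L R) * avg u_x L R
     - avg (\<lambda>w. lorentz w * b_x w) L R / avg lorentz L R
         * (avg b_y L R * avg u_y L R + avg b_z L R * avg u_z L R)
     + tau L R * avg (\<lambda>w. u_x w / beta w) L R
     - avg b_y L R * ec_F7 L R
     - avg b_z L R * ec_F8 L R"

definition ec_R2 :: "state \<Rightarrow> state \<Rightarrow> real" where
  "ec_R2 L R =
     avg rho L R
     - alpha1 L R * avg beta L R
     + 2 * alpha1 L R * avg (\<lambda>w. beta w * u_x w / (lorentz w)\<^sup>2) L R * avg u_x L R
     + 1/2 * (avg (\<lambda>w. (b_y w)\<^sup>2) L R + avg (\<lambda>w. (b_z w)\<^sup>2) L R) * avg beta L R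
     + avg (\<lambda>w. lorentz w * b_x w) L R / avg lorentz L R
         * (avg (\<lambda>w. beta w * u_y w * b_y w / lorentz w) L R
            + avg (\<lambda>w. beta w * u_z w * b_z w / lorentz w) L R)
         * (avg u_x L R / avg lorentz L R)
     - tau L R"

definition ec_R3 :: "state \<Rightarrow> state \<Rightarrow> real" where
  "ec_R3 L R =
     2 * alpha1 L R * avg (\<lambda>w. beta w * u_x w / (lorentz w)\<^sup>2) L R * avg u_y L R
     - avg (\<lambda>w. lorentz w * b_x w) L R / avg lorentz L R
         * (avg beta L R * avg b_y L R
            - avg (\<lambda>w. beta w * u_y w * b_y w / lorentz w) L R * (avg u_y L R / avg lorentz L R)
            - avg (\<lambda>w. beta w * u_z w * b_z w / lorentz w) L R * (avg u_y L R / avg lorentz L R))"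

definition ec_R4 :: "state \<Rightarrow> state \<Rightarrow> real" where
  "ec_R4 L R =
     2 * alpha1 L R * avg (\<lambda>w. beta w * u_x w / (lorentz w)\<^sup>2) L R * avg u_z L R
     - avg (\<lambda>w. lorentz w * b_x w) L R / avg lorentz L R
         * (avg beta L R * avg b_z L R
            - avg (\<lambda>w. beta w * u_y w * b_y w / lorentz w) L R * (avg u_z L R / avg lorentz L R)
            - avg (\<lambda>w. beta w * u_z w * b_z w / lorentz w) L R * (avg u_z L R / avg lorentz L R))"

definition ec_den :: "state \<Rightarrow> state \<Rightarrow> real" where
  "ec_den L R =
     avg beta L R
     * ((avg lorentz L R)\<^sup>2 - (avg u_x L R)\<^sup>2 - (avg u_y L R)\<^sup>2 - (avg u_z L R)\<^sup>2)
     / avg lorentz L R"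

definition ec_F5 :: "real \<Rightarrow> state \<Rightarrow> state \<Rightarrow> real" where
  "ec_F5 G L R =
     inverse (ec_den L R)
     * (avg u_x L R * ec_R2 L R + avg u_y L R * ec_R3 L R + avg u_z L R * ec_R4 L R
        - avg beta L R * ec_R1 G L R)"

definition ec_F2 :: "real \<Rightarrow> state \<Rightarrow> state \<Rightarrow> real" where
  "ec_F2 G L R = avg u_x L R * ec_F5 G L R / avg lorentz L R + ec_R2 L R / avg beta L R"

definition ec_F3 :: "real \<Rightarrow> state \<Rightarrow> state \<Rightarrow> real" where
  "ec_F3 G L R = avg u_y L R * ec_F5 G L R / avg lorentz L R + ec_R3 L R / avg beta L R"

definition ec_F4 :: "real \<Rightarrow> state \<Rightarrow> state \<Rightarrow> real" where
  "ec_F4 G L R = avg u_z L R * ec_F5 G L R / avg lorentz L R + ec_R4 L R / avg beta L R"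

definition ec_flux :: "real \<Rightarrow> state \<Rightarrow> state \<Rightarrow> real ^ 8" where
  "ec_flux G L R = vector
     [ec_F1 L R, ec_F2 G L R, ec_F3 G L R, ec_F4 G L R, ec_F5 G L R, 0, ec_F7 L R, ec_F8 L R]"

end

theory Submission
  imports Defs
begin

text \<open>
  Write \<open>b\<^sub>0 = W (v \<bullet> B)\<close> for the time component of the magnetic four-vector
  \<open>(b\<^sub>0, b)\<close>.  In terms of \<open>u\<close>, \<open>b\<close>, \<open>b\<^sub>0\<close> and \<open>W\<close>, with
  \<open>W\<^sup>2 = 1 + u \<bullet> u\<close> and \<open>u \<bullet> b = W b\<^sub>0\<close>, the physical flux, the potential
  \<open>\<psi>\<^sub>1 = \<rho> u\<^sub>x + \<beta> u\<^sub>x |b|\<^sup>2 / 2\<close> and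
  \<open>\<Phi> = \<beta> b\<^sub>0\<close> become simple expressions without denominators, and
  \<open>B\<^sub>1 = W b\<^sub>x - u\<^sub>x b\<^sub>0\<close>.

  The entropy identity rests on the Leibniz rule
  \<open>[[f g]] = mean f \<cdot> [[g]] + [[f]] \<cdot> mean g\<close>.  The logarithmic means turn the jump of
  \<open>V\<^sub>1\<close> into a combination of \<open>[[\<rho>]]\<close> and \<open>[[\<beta>]]\<close>.  The components
  \<open>F\<^sub>2, \<dots>, F\<^sub>5\<close> solve a linear system: since \<open>W\<^sup>2 - u \<bullet> u = 1\<close> gives
  \<open>mean W \<cdot> [[W]] = mean u \<bullet> [[u]]\<close>, their contribution to
  \<open>[[V]] \<bullet> F\<close> is exactly
  \<open>[[\<beta>]] R\<^sub>1 + [[u\<^sub>x]] R\<^sub>2 + [[u\<^sub>y]] R\<^sub>3 + [[u\<^sub>z]] R\<^sub>4\<close>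
  (\<open>momentum_energy_contribution\<close>).  The system is solvable because the mean of two
  future timelike four-velocities is timelike (\<open>ec_den_nonzero\<close>).

  What is left splits into independent discrete identities, one for each way in which the magnetic
  field enters \<open>[[\<psi>\<^sub>1]] - [[\<Phi>]] mean B\<^sub>1\<close>:
  the squares of \<open>b\<^sub>y\<close> and \<open>b\<^sub>z\<close> (\<open>transverse_pressure\<close>), the square of
  \<open>b\<^sub>x\<close> together with the part of \<open>[[\<Phi>]] mean (W b\<^sub>x)\<close> that comes from
  \<open>u\<^sub>x b\<^sub>x\<close> (\<open>longitudinal_tension\<close>), the parts from \<open>u\<^sub>y b\<^sub>y\<close> and
  \<open>u\<^sub>z b\<^sub>z\<close> (\<open>transverse_tension\<close>), and the terms in \<open>b\<^sub>0\<close>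
  (\<open>time_component\<close>).  Lemma \<open>residual_identity\<close> collects them.

  On the diagonal all means drop out, and the flux reduces to the covariant form of
  \<open>F\<^sub>1\<close>; symmetry is inherited from the means.
\<close>

section \<open>The covariant form of a state\<close>

text \<open>The time component of the magnetic four-vector whose spatial part is \<open>b\<close>.\<close>

definition b0 :: "state \<Rightarrow> real" where
  "b0 w = lorentz w * (vel w \<bullet> mag w)"

lemma lorentz_pos: "admissible w \<Longrightarrow> lorentz w > 0"
  by (simp add: admissible_def lorentz_def abs_square_less_1)

lemma beta_pos: "admissible w \<Longrightarrow> beta w > 0"
  by (simp add: admissible_def beta_def)

lemma vel_eq: "admissible w \<Longrightarrow> vel w = (1 / lorentz w) *\<^sub>R uvec w"
  using lorentz_pos[of w] by (simp add: uvec_def)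

lemma uvec_inner_uvec:
  assumes "admissible w"
  shows "uvec w \<bullet> uvec w = (lorentz w)\<^sup>2 - 1"
proof -
  have "(norm (vel w))\<^sup>2 < 1"
    using assms by (simp add: admissible_def abs_square_less_1)
  then show ?thesis
    by (simp add: uvec_def lorentz_def dot_square_norm power_mult_distrib power_divide field_simps
        flip: power2_eq_square)
qed

lemma bvec_eq:
  assumes "admissible w"
  shows "bvec w = (1 / lorentz w) *\<^sub>R (mag w + b0 w *\<^sub>R uvec w)"
  using lorentz_pos[OF assms] by (simp add: bvec_def b0_def uvec_def scaleR_add_right)

lemma mag_eq:
  assumes "admissible w"
  shows "mag w = lorentz w *\<^sub>R bvec w - b0 w *\<^sub>R uvec w"
  using lorentz_pos[OF assms] by (simp add: bvec_eq[OF assms])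

lemma uvec_inner_bvec:
  assumes "admissible w"
  shows "uvec w \<bullet> bvec w = lorentz w * b0 w"
proof -
  have "uvec w \<bullet> mag w = b0 w"
    by (simp add: uvec_def b0_def)
  then show ?thesis
    using lorentz_pos[OF assms]
    by (simp add: bvec_eq[OF assms] inner_add_right uvec_inner_uvec[OF assms] field_simps power2_eq_square)
qed

text \<open>
  Square \<open>B = W b - b\<^sub>0 u\<close> and eliminate \<open>u \<bullet> u\<close> and \<open>u \<bullet> b\<close>.
\<close>

lemma norm_mag_eq:
  assumes "admissible w"
  shows "(norm (mag w))\<^sup>2 = (lorentz w)\<^sup>2 * (bvec w \<bullet> bvec w) - ((lorentz w)\<^sup>2 + 1) * (b0 w)\<^sup>2"
proof -
  have "(norm (mag w))\<^sup>2 = (lorentz w)\<^sup>2 * (bvec w \<bullet> bvec w) + (b0 w)\<^sup>2 * (uvec w \<bullet> uvec w)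
      - 2 * lorentz w * b0 w * (uvec w \<bullet> bvec w)"
    unfolding power2_norm_eq_inner mag_eq[OF assms]
    by (simp add: inner_diff_left inner_diff_right inner_commute[of "bvec w" "uvec w"]
        algebra_simps power2_eq_square)
  then show ?thesis
    by (simp add: uvec_inner_uvec[OF assms] uvec_inner_bvec[OF assms] algebra_simps power2_eq_square)
qed

text \<open>The Lorentz invariant is the Minkowski square of the four-vector \<open>(b\<^sub>0, b)\<close>.\<close>

lemma bsq_eq:
  assumes "admissible w"
  shows "bsq w = bvec w \<bullet> bvec w - (b0 w)\<^sup>2"
proof -
  have W: "lorentz w > 0" by (rule lorentz_pos[OF assms])
  have k: "vel w \<bullet> mag w = b0 w / lorentz w" using W by (simp add: b0_def)
  show ?thesis
    unfolding bsq_def norm_mag_eq[OF assms] k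
    using W by (simp add: field_simps)
qed

text \<open>
  The next three lemmas identify momentum and flux with entries of the stress-energy tensor
  \<open>(\<rho> h + |b|\<^sup>2) u\<^sup>i u\<^sup>j - b\<^sup>i b\<^sup>j + p\<^sub>t\<^sub>o\<^sub>t g\<^sup>i\<^sup>j\<close> and of the dual
  field tensor \<open>u\<^sup>i b\<^sup>j - b\<^sup>i u\<^sup>j\<close>.
\<close>

lemma cons_m_eq:
  assumes "admissible w"
  shows "cons_m G w = ((rho w * enthalpy G w + bsq w) * lorentz w) *\<^sub>R uvec w - b0 w *\<^sub>R bvec w"
proof -
  have W: "lorentz w > 0" by (rule lorentz_pos[OF assms])
  have k: "vel w \<bullet> mag w = b0 w / lorentz w" using W by (simp add: b0_def)
  have n: "(norm (mag w))\<^sup>2 = (lorentz w)\<^sup>2 * bsq w - (b0 w)\<^sup>2"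
    by (simp add: norm_mag_eq[OF assms] bsq_eq[OF assms] algebra_simps)
  have "(rho w * enthalpy G w * (lorentz w)\<^sup>2 + ((lorentz w)\<^sup>2 * bsq w - (b0 w)\<^sup>2)) / lorentz w
        + (b0 w)\<^sup>2 / lorentz w = (rho w * enthalpy G w + bsq w) * lorentz w"
    using W by (simp add: field_simps power2_eq_square)
  then show ?thesis
    unfolding cons_m_def k n
    using W
    by (simp add: vel_eq[OF assms] mag_eq[OF assms] vec_eq_iff) (simp add: field_simps power2_eq_square)
qed

lemma flux_m_eq:
  assumes "admissible w"
  shows "flux_m G w = ((rho w * enthalpy G w + bsq w) * u_x w) *\<^sub>R uvec w - b_x w *\<^sub>R bvec w
    + ptot w *\<^sub>R axis 1 1"
proof -
  have W: "lorentz w > 0" by (rule lorentz_pos[OF assms])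
  \<comment> \<open>The vector multiplying \<open>B\<^sub>1\<close> in the flux is the definition of \<open>b\<close> divided by \<open>W\<close>.\<close>
  have b: "(1 / (lorentz w)\<^sup>2) *\<^sub>R mag w + (vel w \<bullet> mag w) *\<^sub>R vel w = (1 / lorentz w) *\<^sub>R bvec w"
    using W by (simp add: bvec_def scaleR_add_right power2_eq_square)
  show ?thesis
    unfolding flux_m_def b using W
    by (simp add: cons_m_eq[OF assms] vel_eq[OF assms] mag_eq[OF assms] vec_eq_iff)
       (simp add: field_simps power2_eq_square)
qed

lemma flux_B_eq:
  assumes "admissible w"
  shows "flux_B w = u_x w *\<^sub>R bvec w - b_x w *\<^sub>R uvec w"
  using lorentz_pos[OF assms]
  by (simp add: flux_B_def vel_eq[OF assms] mag_eq[OF assms] vec_eq_iff) (simp add: field_simps)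

lemma Phi_entropy_vars: "admissible w \<Longrightarrow> Phi (entropy_vars G w) = beta w * b0 w"
  by (simp add: Phi_eq beta_def b0_def)

lemma rho_enthalpy:
  assumes "1 < G" "admissible w"
  shows "rho w * enthalpy G w = rho w + G / (G - 1) * prs w"
  using assms by (simp add: enthalpy_eq admissible_def field_simps)

text \<open>
  Contracting the tensors with \<open>(u, - W)\<close> and \<open>b\<close> uses that the four-velocity has square
  \<open>-1\<close> and is orthogonal to \<open>(b\<^sub>0, b)\<close>.  The mixed terms \<open>b\<^sub>x W b\<^sub>0\<close> that survive are
  cancelled by \<open>\<Phi> B\<^sub>1\<close>, and the entropy \<open>s\<close> in \<open>V\<^sub>1\<close> by \<open>q\<^sub>1\<close>.
\<close>

lemma psi1_eq:
  assumes G: "1 < G" and w: "admissible w"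
  shows "psi1 G w = rho w * u_x w + beta w * u_x w * (bvec w \<bullet> bvec w - (b0 w)\<^sup>2) / 2"
proof -
  define H where "H = rho w * enthalpy G w + bsq w"
  define V1 where "V1 = (G - spec_entropy G w) / (G - 1) + beta w"
  have pos: "rho w > 0" "prs w > 0" using w by (auto simp: admissible_def)
  have W: "lorentz w > 0" by (rule lorentz_pos[OF w])
  have "entropy_vars G w \<bullet> phys_flux G w =
      V1 * (rho w * u_x w) + beta w * (uvec w \<bullet> flux_m G w - lorentz w * cons_m G w $ 1 + bvec w \<bullet> flux_B w)"
    using W by (simp add: inner_vec_def sum_8 sum_3 phys_flux_def entropy_vars_def vector_8 V1_def
        beta_def cons_D_def vel_eq[OF w] distrib_left right_diff_distrib)
  also have "uvec w \<bullet> flux_m G w = H * u_x w * ((lorentz w)\<^sup>2 - 1) - b_x w * (lorentz w * b0 w) + ptot w * u_x w"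
    by (simp add: flux_m_eq[OF w] inner_diff_right inner_add_right inner_axis
        uvec_inner_uvec[OF w] uvec_inner_bvec[OF w] H_def)
  also have "bvec w \<bullet> flux_B w = u_x w * (bsq w + (b0 w)\<^sup>2) - b_x w * (lorentz w * b0 w)"
    by (simp add: flux_B_eq[OF w] inner_diff_right bsq_eq[OF w] uvec_inner_bvec[OF w]
        inner_commute[of "bvec w" "uvec w"])
  also have "cons_m G w $ 1 = H * lorentz w * u_x w - b0 w * b_x w"
    by (simp add: cons_m_eq[OF w] H_def)
  finally have VF: "entropy_vars G w \<bullet> phys_flux G w + beta w * b0 w * mag w $ 1 =
      V1 * (rho w * u_x w) + beta w * u_x w * (ptot w + bsq w - H)"
    by (simp add: mag_eq[OF w] algebra_simps power2_eq_square)
  have q: "q1 G w = - (rho w * u_x w) * (spec_entropy G w / (G - 1))"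
    using W by (simp add: q1_def vel_eq[OF w])
  have r: "beta w * prs w = rho w" using pos by (simp add: beta_def)
  have "V1 + spec_entropy G w / (G - 1) = G / (G - 1) + beta w"
    by (simp add: V1_def diff_divide_distrib)
  moreover have "psi1 G w = (V1 + spec_entropy G w / (G - 1)) * (rho w * u_x w)
      + beta w * u_x w * (ptot w + bsq w - H)"
    unfolding psi1_def Phi_entropy_vars[OF w] VF q by (simp add: algebra_simps)
  ultimately have "psi1 G w = (G / (G - 1) + beta w) * (rho w * u_x w)
      + beta w * u_x w * (ptot w + bsq w - H)"
    by simp
  also have "ptot w + bsq w - H = prs w - rho w - G / (G - 1) * prs w + bsq w / 2"
    by (simp add: H_def ptot_def rho_enthalpy[OF G w])
  also have "(G / (G - 1) + beta w) * (rho w * u_x w)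
      + beta w * u_x w * (prs w - rho w - G / (G - 1) * prs w + bsq w / 2)
      = G / (G - 1) * u_x w * (rho w - beta w * prs w) + u_x w * (beta w * prs w) + beta w * u_x w * bsq w / 2"
    by (simp add: distrib_left distrib_right left_diff_distrib right_diff_distrib
        diff_divide_distrib mult_ac)
  finally show ?thesis by (simp add: r bsq_eq[OF w] mult.commute)
qed

section \<open>Jumps and means\<close>

lemma avg_diag [simp]: "avg a w w = a w"
  by (simp add: avg_def)

lemma log_mean_diag [simp]: "log_mean a w w = a w"
  by (simp add: log_mean_def)

lemma avg_commute: "avg a L R = avg a R L"
  by (simp add: avg_def add.commute)

text \<open>Exchanging the states changes the sign of numerator and denominator.\<close>

lemma log_mean_commute: "log_mean a L R = log_mean a R L"
proof -
  have "(a R - a L) / (ln (a R) - ln (a L)) = (a L - a R) / (ln (a L) - ln (a R))"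
    using minus_divide_divide[of "a R - a L" "ln (a R) - ln (a L)"] by simp
  then show ?thesis
    by (simp add: log_mean_def jump_def)
qed

lemma avg_pos: "a L > 0 \<Longrightarrow> a R > 0 \<Longrightarrow> avg a L R > 0"
  by (simp add: avg_def)

lemma jump_mult:
  fixes f g :: "state \<Rightarrow> real"
  shows "jump (\<lambda>w. f w * g w) L R = avg f L R * jump g L R + jump f L R * avg g L R"
  by (simp add: jump_def avg_def field_simps)

lemma log_mean_nonzero:
  assumes "a L > 0" "a R > 0"
  shows "log_mean a L R \<noteq> 0"
  using assms by (simp add: log_mean_def jump_def)

text \<open>
  If the two values agree, both sides are 0, so the degenerate branch of the logarithmic mean is
  covered as well.
\<close>

lemma jump_ln:
  assumes "a L > 0" "a R > 0"
  shows "jump (\<lambda>w. ln (a w)) L R = jump a L R / log_mean a L R"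
  using assms by (simp add: log_mean_def jump_def)

text \<open>
  Eliminating the pressure by \<open>ln p = ln \<rho> - ln \<beta>\<close> gives
  \<open>V\<^sub>1 = \<Gamma>/(\<Gamma> - 1) + ln \<rho> + ln \<beta> / (\<Gamma> - 1) + \<beta>\<close>; this is where the two
  logarithmic means of the flux and the constant \<open>\<alpha>\<^sub>0\<close> come from.
\<close>

lemma jump_V1:
  assumes G: "1 < G" and L: "admissible L" and R: "admissible R"
  shows "jump (entropy_vars G) L R $ 1 = jump rho L R / log_mean rho L R + alpha0 G L R * jump beta L R"
proof -
  have V1: "entropy_vars G w $ 1 = G / (G - 1) + ln (rho w) + ln (beta w) / (G - 1) + beta w"
    if "admissible w" for w
  proof -
    have "ln (beta w) = ln (rho w) - ln (prs w)"
      using that by (simp add: beta_def ln_div admissible_def)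
    moreover define H where "H = G - 1"
    moreover have "H \<noteq> 0" "G = H + 1" using G by (simp_all add: H_def)
    ultimately show ?thesis
      by (simp add: entropy_vars_def vector_8 spec_entropy_def flip: beta_def)
         (simp add: field_simps)
  qed
  have "jump (entropy_vars G) L R $ 1 =
      jump (\<lambda>w. ln (rho w)) L R + jump (\<lambda>w. ln (beta w)) L R / (G - 1) + jump beta L R"
    by (simp add: jump_def V1[OF L] V1[OF R] diff_divide_distrib)
  also have "\<dots> = jump rho L R / log_mean rho L R + alpha0 G L R * jump beta L R"
    using L R beta_pos[OF L] beta_pos[OF R]
    by (simp add: jump_ln admissible_def alpha0_def algebra_simps)
  finally show ?thesis .
qed

text \<open>
  Mean times jump is half the jump of the square, and \<open>u \<bullet> u\<close> and \<open>W\<^sup>2\<close> differ by a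
  constant.
\<close>

lemma avg_lorentz_jump:
  assumes "admissible L" "admissible R"
  shows "avg u_x L R * jump u_x L R + avg u_y L R * jump u_y L R + avg u_z L R * jump u_z L R =
    avg lorentz L R * jump lorentz L R"
proof -
  have sq: "avg f L R * jump f L R = ((f R)\<^sup>2 - (f L)\<^sup>2) / 2" for f :: "state \<Rightarrow> real"
    by (simp add: jump_def avg_def field_simps power2_eq_square)
  show ?thesis
    unfolding sq using uvec_inner_uvec[OF assms(1)] uvec_inner_uvec[OF assms(2)]
    by (simp add: inner_vec_def sum_3 field_simps power2_eq_square)
qed

text \<open>
  Each state satisfies \<open>|u| < W\<close>, so the Cauchy-Schwarz inequality gives
  \<open>u\<^sub>L \<bullet> u\<^sub>R < W\<^sub>L W\<^sub>R\<close>; hence the averaged four-velocity stays timelike.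
\<close>

lemma ec_den_nonzero:
  assumes L: "admissible L" and R: "admissible R"
  shows "ec_den L R \<noteq> 0"
proof -
  have W: "lorentz L > 0" "lorentz R > 0" by (simp_all add: lorentz_pos L R)
  have n: "norm (uvec w) < lorentz w" if "admissible w" for w
    using that lorentz_pos[OF that] by (simp add: uvec_def admissible_def)
  have "uvec L \<bullet> uvec R \<le> norm (uvec L) * norm (uvec R)"
    by (rule norm_cauchy_schwarz)
  also have "\<dots> < lorentz L * lorentz R"
    using n[OF L] n[OF R] by (intro mult_strict_mono') auto
  finally have "0 < lorentz L * lorentz R - uvec L \<bullet> uvec R" by simp
  moreover have "(avg lorentz L R)\<^sup>2 - (avg u_x L R)\<^sup>2 - (avg u_y L R)\<^sup>2 - (avg u_z L R)\<^sup>2 =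
      (1 + (lorentz L * lorentz R - uvec L \<bullet> uvec R)) / 2"
    using uvec_inner_uvec[OF L] uvec_inner_uvec[OF R]
    by (simp add: inner_vec_def sum_3 avg_def field_simps power2_eq_square)
  ultimately have "(avg lorentz L R)\<^sup>2 - (avg u_x L R)\<^sup>2 - (avg u_y L R)\<^sup>2 - (avg u_z L R)\<^sup>2 > 0"
    by simp
  then show ?thesis
    using W avg_pos[of beta L R] beta_pos[OF L] beta_pos[OF R] avg_pos[of lorentz L R]
    by (simp add: ec_den_def)
qed

section \<open>Consistency and symmetry\<close>

text \<open>
  With equal states \<open>\<alpha>\<^sub>1 = b\<^sub>x\<^sup>2 / 2\<close>, \<open>\<tau> = \<beta> b\<^sub>0\<^sup>2 / 2\<close> and
  \<open>\<alpha>\<^sub>0 \<rho> + p = \<rho> h\<close>.  The transverse product \<open>u\<^sub>y b\<^sub>y + u\<^sub>z b\<^sub>z\<close> equals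
  \<open>W b\<^sub>0 - u\<^sub>x b\<^sub>x\<close>, and this replacement merges it with the \<open>\<alpha>\<^sub>1\<close> terms into
  \<open>b\<^sub>x b\<^sub>0 / W\<close>; the energy flux then comes out as
  \<open>(\<rho> h + |b|\<^sup>2) W u\<^sub>x - b\<^sub>0 b\<^sub>x\<close>.
\<close>

lemma ec_flux_diag:
  assumes G: "1 < G" and w: "admissible w"
  shows "ec_flux G w w = phys_flux G w"
proof -
  define W where "W = lorentz w"
  define be where "be = beta w"
  define b where "b = b0 w"
  define x where "x = b_x w"
  define y where "y = b_y w"
  define z where "z = b_z w"
  define u where "u = u_x w"
  define v where "v = u_y w"
  define t where "t = u_z w"
  define P where "P = rho w * enthalpy G w"
  define S where "S = bsq w"
  note defs = W_def be_def b_def x_def y_def z_def u_def v_def t_def P_def S_def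
  have pos: "W > 0" "be > 0" "prs w > 0" "rho w > 0"
    using lorentz_pos[OF w] beta_pos[OF w] w by (simp_all add: W_def be_def admissible_def)
  have r: "rho w = be * prs w" using pos by (simp add: be_def beta_def)
  have ub: "uvec w \<bullet> bvec w = W * b" by (simp add: uvec_inner_bvec[OF w] W_def b_def)
  have ub': "v * y + t * z = W * b - u * x"
    using ub by (simp add: inner_vec_def sum_3 defs)
  have uu: "W\<^sup>2 - u\<^sup>2 - v\<^sup>2 - t\<^sup>2 = 1"
    using uvec_inner_uvec[OF w] by (simp add: inner_vec_def sum_3 defs power2_eq_square)
  have bb: "y\<^sup>2 + z\<^sup>2 = S + b\<^sup>2 - x\<^sup>2"
    using bsq_eq[OF w] by (simp add: inner_vec_def sum_3 defs power2_eq_square)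
  have a0: "alpha0 G w w * rho w + prs w = P"
    unfolding P_def rho_enthalpy[OF G w] using G pos
    by (simp add: alpha0_def r be_def[symmetric] field_simps)
  have a1: "alpha1 w w = x\<^sup>2 / 2"
    using pos by (simp add: alpha1_def defs[symmetric] field_simps power2_eq_square)
  have ta: "tau w w = be * b\<^sup>2 / 2"
    using pos by (simp add: tau_def inner_commute[of "bvec w"] ub flip: defs)
       (simp add: field_simps power2_eq_square)
  have F1: "ec_F1 w w = rho w * u"
    by (simp add: ec_F1_def defs)
  have F7: "ec_F7 w w = u * y - x * v" and F8: "ec_F8 w w = u * z - x * t"
    using pos by (simp_all add: ec_F7_def ec_F8_def flip: defs)
  have R1: "ec_R1 G w w = - (alpha0 G w w * rho w + S / 2) * u"
  proof -
    have "ec_R1 G w w = - (alpha0 G w w * rho w) * u - x\<^sup>2 / 2 * u + 1/2 * (y\<^sup>2 + z\<^sup>2) * u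
        + b\<^sup>2 / 2 * u - (y\<^sup>2 + z\<^sup>2) * u"
      using pos by (simp add: ec_R1_def F1 F7 F8 a1 ta flip: defs)
        (simp add: field_simps power2_eq_square)
    also have "\<dots> = - (alpha0 G w w * rho w) * u - S / 2 * u"
      unfolding bb by (simp add: field_simps)
    finally show ?thesis using pos by (simp add: algebra_simps)
  qed
  have q: "be * v * y / W + be * t * z / W = be * (W * b - u * x) / W"
    unfolding ub'[symmetric] by (simp add: algebra_simps add_divide_distrib)
  have R2: "ec_R2 w w = be * (prs w + S / 2 - x\<^sup>2 + x * u * b / W)"
    using pos by (simp add: ec_R2_def a1 ta q bb flip: defs)
       (simp add: r field_simps power2_eq_square)
  have R3: "ec_R3 w w = be * (x * v * b / W - x * y)"
  proof -
    have "ec_R3 w w = x\<^sup>2 * (be * u / W\<^sup>2) * v - x * be * y + x * (be * v * y / W + be * t * z / W) * v / W"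
      using pos by (simp add: ec_R3_def a1 flip: defs) (simp add: field_simps)
    also have "\<dots> = be * (x * v * b / W - x * y)"
      unfolding q using pos by (simp add: field_simps power2_eq_square)
    finally show ?thesis .
  qed
  have R4: "ec_R4 w w = be * (x * t * b / W - x * z)"
  proof -
    have "ec_R4 w w = x\<^sup>2 * (be * u / W\<^sup>2) * t - x * be * z + x * (be * v * y / W + be * t * z / W) * t / W"
      using pos by (simp add: ec_R4_def a1 flip: defs) (simp add: field_simps)
    also have "\<dots> = be * (x * t * b / W - x * z)"
      unfolding q using pos by (simp add: field_simps power2_eq_square)
    finally show ?thesis .
  qed
  have F5: "ec_F5 G w w = (P + S) * W * u - b * x"
  proof -
    have D: "inverse (ec_den w w) = W / be"
      using pos uu by (simp add: ec_den_def flip: defs)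
    have uu': "u\<^sup>2 + v\<^sup>2 + t\<^sup>2 = W\<^sup>2 - 1" using uu by simp
    have "u * ec_R2 w w + v * ec_R3 w w + t * ec_R4 w w =
        be * (u * (prs w + S / 2) + x * b / W * (u\<^sup>2 + v\<^sup>2 + t\<^sup>2) - x * (u * x + (v * y + t * z)))"
      unfolding R2 R3 R4 by (simp add: algebra_simps power2_eq_square)
    also have "\<dots> = be * (u * (prs w + S / 2) - x * b / W)"
      unfolding uu' ub' using pos by (simp add: field_simps power2_eq_square)
    finally have "u * ec_R2 w w + v * ec_R3 w w + t * ec_R4 w w - be * ec_R1 G w w =
        be * (u * (alpha0 G w w * rho w + prs w + S) - x * b / W)"
      unfolding R1 using pos by (simp add: field_simps)
    then show ?thesis
      unfolding ec_F5_def D a0 using pos by (simp add: a0 flip: defs) (simp add: field_simps)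
  qed
  have F2: "ec_F2 G w w = (P + S) * u * u - x * x + ptot w"
    using pos by (simp add: ec_F2_def F5 R2 ptot_def flip: defs) (simp add: field_simps power2_eq_square)
  have F3: "ec_F3 G w w = (P + S) * u * v - x * y" and F4: "ec_F4 G w w = (P + S) * u * t - x * z"
    using pos by (simp_all add: ec_F3_def ec_F4_def F5 R3 R4 flip: defs)
      (simp_all add: field_simps power2_eq_square)
  have "cons_D w * vel w $ 1 = rho w * u"
    using pos by (simp add: cons_D_def vel_eq[OF w] defs)
  then show ?thesis
    unfolding vec_eq_iff forall_8 ec_flux_def phys_flux_def vector_8 F1 F2 F3 F4 F5 F7 F8
    by (simp add: flux_m_eq[OF w] cons_m_eq[OF w] flux_B_eq[OF w] axis_def flip: defs)
qed

lemma ec_flux_commute: "ec_flux G L R = ec_flux G R L"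
proof -
  note c = avg_commute[of _ R L] log_mean_commute[of _ R L]
  have a0: "alpha0 G R L = alpha0 G L R" by (simp add: alpha0_def c)
  have a1: "alpha1 R L = alpha1 L R" by (simp add: alpha1_def c mult_ac)
  have ta: "tau R L = tau L R" by (simp add: tau_def c mult_ac)
  have F: "ec_F1 R L = ec_F1 L R" "ec_F7 R L = ec_F7 L R" "ec_F8 R L = ec_F8 L R"
    by (simp_all add: ec_F1_def ec_F7_def ec_F8_def c)
  have R: "ec_R1 G R L = ec_R1 G L R" "ec_R2 R L = ec_R2 L R" "ec_R3 R L = ec_R3 L R" "ec_R4 R L = ec_R4 L R"
    by (simp_all add: ec_R1_def ec_R2_def ec_R3_def ec_R4_def c a0 a1 ta F)
  have F5: "ec_F5 G R L = ec_F5 G L R"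
    by (simp add: ec_F5_def ec_den_def c R)
  show ?thesis
    by (simp add: ec_flux_def ec_F2_def ec_F3_def ec_F4_def c F F5 R)
qed

section \<open>The entropy identity\<close>

text \<open>
  By the Leibniz rule the coefficient of \<open>[[\<beta>]]\<close> is
  \<open>mean u \<bullet> (F\<^sub>2, F\<^sub>3, F\<^sub>4) - mean W \<cdot> F\<^sub>5\<close>, which \<open>F\<^sub>5\<close> is chosen to make equal to
  \<open>R\<^sub>1\<close>.  The jump of \<open>W\<close> is a combination of the jumps of \<open>u\<close>, and the term
  \<open>mean u \<cdot> F\<^sub>5 / mean W\<close> in \<open>F\<^sub>2, F\<^sub>3, F\<^sub>4\<close> absorbs it, leaving \<open>R\<^sub>2, R\<^sub>3, R\<^sub>4\<close>.
\<close>

lemma momentum_energy_contribution: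
  assumes L: "admissible L" and R: "admissible R"
  shows "jump (\<lambda>w. beta w * u_x w) L R * ec_F2 G L R + jump (\<lambda>w. beta w * u_y w) L R * ec_F3 G L R
      + jump (\<lambda>w. beta w * u_z w) L R * ec_F4 G L R - jump (\<lambda>w. beta w * lorentz w) L R * ec_F5 G L R
    = jump beta L R * ec_R1 G L R + jump u_x L R * ec_R2 L R + jump u_y L R * ec_R3 L R
      + jump u_z L R * ec_R4 L R"
proof -
  define F where "F = ec_F5 G L R"
  define be where "be = avg beta L R"
  define W where "W = avg lorentz L R"
  define x where "x = avg u_x L R"
  define y where "y = avg u_y L R"
  define z where "z = avg u_z L R"
  note defs = F_def be_def W_def x_def y_def z_def
  have pos: "be > 0" "W > 0"
    using avg_pos[of beta L R] avg_pos[of lorentz L R] beta_pos lorentz_pos L R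
    by (simp_all add: be_def W_def)
  have "ec_den L R * F = x * ec_R2 L R + y * ec_R3 L R + z * ec_R4 L R - be * ec_R1 G L R"
    using ec_den_nonzero[OF L R] by (simp add: defs ec_F5_def)
  then have "ec_R1 G L R = (x * ec_R2 L R + y * ec_R3 L R + z * ec_R4 L R - ec_den L R * F) / be"
    using pos by (simp add: field_simps)
  then have R1: "x * ec_F2 G L R + y * ec_F3 G L R + z * ec_F4 G L R - W * F = ec_R1 G L R"
    using pos by (simp add: ec_den_def ec_F2_def ec_F3_def ec_F4_def flip: defs)
      (simp add: field_simps power2_eq_square)
  have R234: "be * ec_F2 G L R = be * x * F / W + ec_R2 L R" "be * ec_F3 G L R = be * y * F / W + ec_R3 L R"
      "be * ec_F4 G L R = be * z * F / W + ec_R4 L R"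
    using pos by (simp_all add: ec_F2_def ec_F3_def ec_F4_def field_simps flip: defs)
  have jW: "jump lorentz L R = (x * jump u_x L R + y * jump u_y L R + z * jump u_z L R) / W"
    using avg_lorentz_jump[OF L R] pos by (simp add: defs)
  have "jump (\<lambda>w. beta w * u_x w) L R * ec_F2 G L R + jump (\<lambda>w. beta w * u_y w) L R * ec_F3 G L R
      + jump (\<lambda>w. beta w * u_z w) L R * ec_F4 G L R - jump (\<lambda>w. beta w * lorentz w) L R * ec_F5 G L R
    = jump beta L R * (x * ec_F2 G L R + y * ec_F3 G L R + z * ec_F4 G L R - W * F)
      + jump u_x L R * (be * ec_F2 G L R) + jump u_y L R * (be * ec_F3 G L R)
      + jump u_z L R * (be * ec_F4 G L R) - be * jump lorentz L R * F"
    unfolding jump_mult by (simp add: algebra_simps flip: defs)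
  also have "\<dots> = jump beta L R * ec_R1 G L R + jump u_x L R * ec_R2 L R + jump u_y L R * ec_R3 L R
      + jump u_z L R * ec_R4 L R"
    unfolding R1 R234 jW using pos by (simp add: field_simps)
  finally show ?thesis .
qed

text \<open>
  In the following two identities everything cancels except the product of the values at the two
  states.  They are the reason why \<open>\<alpha>\<^sub>1\<close> and \<open>\<tau>\<close> contain products of a left and a right
  value in place of means.
\<close>

lemma jump_square_mean_weighted:
  fixes Y c :: "state \<Rightarrow> real"
  shows "jump (\<lambda>w. Y w * (c w)\<^sup>2 / 2) L R - jump (\<lambda>w. Y w * c w) L R * avg c L R =
    - (c L * c R / 2) * jump Y L R"
  by (simp add: jump_def avg_def field_simps power2_eq_square)

lemma jump_square_weighted_mean:
  fixes Z g :: "state \<Rightarrow> real"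
  shows "jump g L R * avg (\<lambda>w. Z w * g w) L R - jump (\<lambda>w. Z w * (g w)\<^sup>2 / 2) L R =
    - (g L * g R / 2) * jump Z L R"
  by (simp add: jump_def avg_def field_simps power2_eq_square)

text \<open>
  This is the Leibniz rule for the product of \<open>f g\<close> and \<open>b\<^sup>2 / 2\<close>, used with
  \<open>f = \<beta>\<close>, \<open>g = u\<^sub>x\<close> and \<open>b\<close> a transverse field component.
\<close>

lemma transverse_pressure:
  fixes f g b :: "state \<Rightarrow> real"
  shows "avg (\<lambda>w. f w * g w) L R * (avg b L R * jump b L R)
    + 1/2 * avg (\<lambda>w. (b w)\<^sup>2) L R * (jump f L R * avg g L R + avg f L R * jump g L R) =
    jump (\<lambda>w. f w * g w * (b w)\<^sup>2 / 2) L R"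
  by (simp add: jump_def avg_def field_simps power2_eq_square)

text \<open>
  With \<open>Y = \<beta> u\<^sub>x / W\<^sup>2\<close>, the Leibniz rule for \<open>\<beta> u\<^sub>x = Y W\<^sup>2\<close> reduces the left
  side to \<open>- \<alpha>\<^sub>1 \<cdot> mean (W\<^sup>2) \<cdot> [[Y]]\<close>.  The denominator of \<open>\<alpha>\<^sub>1\<close> cancels the mean
  of \<open>W\<^sup>2\<close>, and \<open>jump_square_mean_weighted\<close> applies with \<open>c = W b\<^sub>x\<close>.
\<close>

lemma longitudinal_tension:
  assumes L: "admissible L" and R: "admissible R"
  shows "alpha1 L R * (2 * avg (\<lambda>w. beta w * u_x w / (lorentz w)\<^sup>2) L R * (avg lorentz L R * jump lorentz L R)
      - (avg u_x L R * jump beta L R + avg beta L R * jump u_x L R)) =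
    jump (\<lambda>w. beta w * u_x w * (b_x w)\<^sup>2 / 2) L R
    - jump (\<lambda>w. beta w * u_x w * b_x w / lorentz w) L R * avg (\<lambda>w. lorentz w * b_x w) L R"
proof -
  define Y where "Y w = beta w * u_x w / (lorentz w)\<^sup>2" for w
  define c where "c w = lorentz w * b_x w" for w
  define M where "M = avg (\<lambda>w. (lorentz w)\<^sup>2) L R"
  have W: "lorentz L > 0" "lorentz R > 0" by (simp_all add: lorentz_pos L R)
  have M: "M > 0" using W by (simp add: M_def avg_def add_pos_pos)
  have "jump (\<lambda>w. beta w * u_x w) L R = jump (\<lambda>w. Y w * (lorentz w)\<^sup>2) L R"
    using W by (simp add: jump_def Y_def)
  also have "\<dots> = avg Y L R * jump (\<lambda>w. (lorentz w)\<^sup>2) L R + jump Y L R * M"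
    unfolding jump_mult M_def ..
  also have "jump (\<lambda>w. (lorentz w)\<^sup>2) L R = 2 * (avg lorentz L R * jump lorentz L R)"
    by (simp add: power2_eq_square jump_mult)
  finally have "2 * avg Y L R * (avg lorentz L R * jump lorentz L R)
      - (avg u_x L R * jump beta L R + avg beta L R * jump u_x L R) = - jump Y L R * M"
    unfolding jump_mult by (simp add: algebra_simps)
  moreover have "alpha1 L R = c L * c R / 2 / M"
    by (simp add: alpha1_def c_def M_def mult_ac)
  ultimately have "alpha1 L R * (2 * avg Y L R * (avg lorentz L R * jump lorentz L R)
      - (avg u_x L R * jump beta L R + avg beta L R * jump u_x L R)) = - (c L * c R / 2) * jump Y L R"
    using M by simp
  also have "\<dots> = jump (\<lambda>w. Y w * (c w)\<^sup>2 / 2) L R - jump (\<lambda>w. Y w * c w) L R * avg c L R"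
    by (rule jump_square_mean_weighted[symmetric])
  also have "jump (\<lambda>w. Y w * (c w)\<^sup>2 / 2) L R = jump (\<lambda>w. beta w * u_x w * (b_x w)\<^sup>2 / 2) L R"
    using W by (simp add: jump_def Y_def c_def power_mult_distrib)
  also have "jump (\<lambda>w. Y w * c w) L R = jump (\<lambda>w. beta w * u_x w * b_x w / lorentz w) L R"
    using W by (simp add: jump_def Y_def c_def power2_eq_square)
  finally show ?thesis unfolding Y_def c_def .
qed

text \<open>
  With \<open>Z = u\<^sub>x / \<beta>\<close>, the Leibniz rule for \<open>u\<^sub>x = Z \<beta>\<close> reduces the left side to
  \<open>- \<tau> \<cdot> mean \<beta> \<cdot> [[Z]]\<close>, and \<open>\<tau>\<close> is the product of the two values of
  \<open>g = \<beta> b\<^sub>0\<close> divided by twice the mean of \<open>\<beta>\<close>.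
\<close>

lemma time_component:
  assumes L: "admissible L" and R: "admissible R"
  shows "tau L R * (avg (\<lambda>w. u_x w / beta w) L R * jump beta L R - jump u_x L R) =
    jump (\<lambda>w. beta w * b0 w) L R * avg (\<lambda>w. u_x w * b0 w) L R
    - jump (\<lambda>w. beta w * u_x w * (b0 w)\<^sup>2 / 2) L R"
proof -
  define Z where "Z w = u_x w / beta w" for w
  define g where "g w = beta w * b0 w" for w
  define be where "be = avg beta L R"
  have W: "lorentz L > 0" "lorentz R > 0" and b: "beta L > 0" "beta R > 0" "be > 0"
    using avg_pos[of beta L R] by (simp_all add: lorentz_pos beta_pos L R be_def)
  have "jump u_x L R = jump (\<lambda>w. Z w * beta w) L R"
    using b by (simp add: jump_def Z_def)
  then have "avg Z L R * jump beta L R - jump u_x L R = - jump Z L R * be"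
    unfolding jump_mult be_def by simp
  moreover have "tau L R = g L * g R / 2 / be"
    using W by (simp add: tau_def g_def be_def inner_commute[of "bvec _"] uvec_inner_bvec L R)
  ultimately have "tau L R * (avg Z L R * jump beta L R - jump u_x L R) = - (g L * g R / 2) * jump Z L R"
    using b by simp
  also have "\<dots> = jump g L R * avg (\<lambda>w. Z w * g w) L R - jump (\<lambda>w. Z w * (g w)\<^sup>2 / 2) L R"
    by (rule jump_square_weighted_mean[symmetric])
  also have "avg (\<lambda>w. Z w * g w) L R = avg (\<lambda>w. u_x w * b0 w) L R"
    using b by (simp add: avg_def Z_def g_def)
  also have "jump (\<lambda>w. Z w * (g w)\<^sup>2 / 2) L R = jump (\<lambda>w. beta w * u_x w * (b0 w)\<^sup>2 / 2) L R"
    using b by (simp add: jump_def Z_def g_def power2_eq_square mult_ac)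
  finally show ?thesis unfolding Z_def g_def .
qed

text \<open>
  The jump of \<open>\<beta> c b\<close> is expanded in two ways, as the product of
  \<open>\<beta> c b / W\<close> with \<open>W\<close> and as the product of \<open>\<beta> c\<close> with \<open>b\<close>; the identity is
  used with \<open>c\<close> and \<open>b\<close> the same transverse component of \<open>u\<close> and of the magnetic field.
\<close>

lemma transverse_tension:
  fixes b c :: "state \<Rightarrow> real"
  assumes L: "admissible L" and R: "admissible R"
  shows "avg (\<lambda>w. beta w * c w * b w / lorentz w) L R * jump lorentz L R
      - jump beta L R * (avg b L R * avg c L R) - avg beta L R * avg b L R * jump c L R
      - avg (\<lambda>w. beta w * c w) L R * jump b L R =
    - avg lorentz L R * jump (\<lambda>w. beta w * c w * b w / lorentz w) L R"
proof -
  define X where "X w = beta w * c w * b w / lorentz w" for w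
  have W: "lorentz L > 0" "lorentz R > 0" by (simp_all add: lorentz_pos L R)
  have "jump (\<lambda>w. X w * lorentz w) L R = jump (\<lambda>w. beta w * c w * b w) L R"
    using W by (simp add: jump_def X_def)
  then have "avg X L R * jump lorentz L R + jump X L R * avg lorentz L R =
      avg (\<lambda>w. beta w * c w) L R * jump b L R
      + (avg beta L R * jump c L R + jump beta L R * avg c L R) * avg b L R"
    unfolding jump_mult .
  then show ?thesis unfolding X_def[symmetric] by (simp add: algebra_simps)
qed

text \<open>
  After inserting \<open>F\<^sub>7\<close>, \<open>F\<^sub>8\<close> and \<open>R\<^sub>1, \<dots>, R\<^sub>4\<close>, the left side is regrouped by the
  dependence on \<open>\<rho>\<close>, \<open>\<alpha>\<^sub>1\<close>, \<open>\<tau>\<close>, the mean squares of \<open>b\<^sub>y\<close> and \<open>b\<^sub>z\<close>, and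
  \<open>k = mean (W b\<^sub>x) / mean W\<close>.  Wherever \<open>mean u \<bullet> [[u]]\<close> occurs it becomes
  \<open>mean W \<cdot> [[W]]\<close>; the \<open>\<rho>\<close> group is then an instance of the Leibniz rule, and every other
  group is one of the identities above.  The terms \<open>\<alpha>\<^sub>0 F\<^sub>1\<close>, \<open>mean b\<^sub>y \<cdot> F\<^sub>7\<close> and \<open>mean b\<^sub>z \<cdot> F\<^sub>8\<close> in
  \<open>R\<^sub>1\<close> cancel the parts of \<open>[[V\<^sub>1]]\<close>, \<open>[[\<beta> b\<^sub>y]]\<close> and \<open>[[\<beta> b\<^sub>z]]\<close> proportional
  to \<open>[[\<beta>]]\<close>.
\<close>

lemma residual_identity:
  assumes L: "admissible L" and R: "admissible R"
  shows "jump rho L R * avg u_x L R + alpha0 G L R * jump beta L R * ec_F1 L R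
      + jump beta L R * ec_R1 G L R + jump u_x L R * ec_R2 L R + jump u_y L R * ec_R3 L R
      + jump u_z L R * ec_R4 L R
      + jump (\<lambda>w. beta w * b_y w) L R * ec_F7 L R + jump (\<lambda>w. beta w * b_z w) L R * ec_F8 L R =
    jump (\<lambda>w. rho w * u_x w) L R + jump (\<lambda>w. beta w * u_x w * (b_x w)\<^sup>2 / 2) L R
      + jump (\<lambda>w. beta w * u_x w * (b_y w)\<^sup>2 / 2) L R + jump (\<lambda>w. beta w * u_x w * (b_z w)\<^sup>2 / 2) L R
      - jump (\<lambda>w. beta w * u_x w * (b0 w)\<^sup>2 / 2) L R
      + jump (\<lambda>w. beta w * b0 w) L R * avg (\<lambda>w. u_x w * b0 w) L R
      - avg (\<lambda>w. lorentz w * b_x w) L R * (jump (\<lambda>w. beta w * u_x w * b_x w / lorentz w) L R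
        + jump (\<lambda>w. beta w * u_y w * b_y w / lorentz w) L R
        + jump (\<lambda>w. beta w * u_z w * b_z w / lorentz w) L R)"
proof -
  define W where "W = avg lorentz L R"
  define be where "be = avg beta L R"
  define c where "c = avg (\<lambda>w. lorentz w * b_x w) L R"
  define k where "k = c / W"
  define Qy where "Qy = avg (\<lambda>w. beta w * u_y w * b_y w / lorentz w) L R"
  define Qz where "Qz = avg (\<lambda>w. beta w * u_z w * b_z w / lorentz w) L R"
  define bu where "bu = avg (\<lambda>w. beta w * u_x w) L R"
  define bv where "bv = avg (\<lambda>w. beta w * u_y w) L R"
  define bt where "bt = avg (\<lambda>w. beta w * u_z w) L R"
  define x where "x = avg u_x L R"
  define y where "y = avg u_y L R"
  define z where "z = avg u_z L R"
  define j where "j = jump lorentz L R"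
  define m where "m = avg (\<lambda>w. beta w * u_x w / (lorentz w)\<^sup>2) L R"
  define a where "a = alpha1 L R"
  define t where "t = tau L R"
  define By where "By = avg b_y L R"
  define Bz where "Bz = avg b_z L R"
  define By2 where "By2 = avg (\<lambda>w. (b_y w)\<^sup>2) L R"
  define Bz2 where "Bz2 = avg (\<lambda>w. (b_z w)\<^sup>2) L R"
  define Z where "Z = avg (\<lambda>w. u_x w / beta w) L R"
  define jb where "jb = jump beta L R"
  define jx where "jx = jump u_x L R"
  define jy where "jy = jump u_y L R"
  define jz where "jz = jump u_z L R"
  define jBy where "jBy = jump b_y L R"
  define jBz where "jBz = jump b_z L R"
  note defs = W_def be_def c_def Qy_def Qz_def bu_def bv_def bt_def x_def y_def z_def
    j_def m_def a_def t_def By_def Bz_def By2_def Bz2_def Z_def jb_def jx_def jy_def jz_def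
    jBy_def jBz_def
  have pos: "be > 0" "W > 0"
    using avg_pos[of beta L R] avg_pos[of lorentz L R] beta_pos lorentz_pos L R
    by (simp_all add: be_def W_def)
  have kW: "k * (- W * X) = - (c * X)" for X using pos by (simp add: k_def)
  have J: "x * jx + y * jy + z * jz = W * j"
    unfolding defs by (rule avg_lorentz_jump[OF L R])
  have F7: "be * ec_F7 L R = bu * By - k * bv" and F8: "be * ec_F8 L R = bu * Bz - k * bt"
    using pos by (simp_all add: ec_F7_def ec_F8_def k_def flip: defs)  (simp_all add: field_simps)
  have R1: "ec_R1 G L R = - alpha0 G L R * ec_F1 L R - a * x + 1/2 * (By2 + Bz2) * x
      - k * (By * y + Bz * z) + t * Z - By * ec_F7 L R - Bz * ec_F8 L R"
    by (simp add: ec_R1_def k_def flip: defs)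
  have R2: "ec_R2 L R = avg rho L R - a * be + 2 * a * m * x + 1/2 * (By2 + Bz2) * be
      + k * (Qy + Qz) * (x / W) - t"
    by (simp add: ec_R2_def k_def flip: defs)
  have R3: "ec_R3 L R = 2 * a * m * y - k * be * By + k * (Qy + Qz) * (y / W)"
  proof -
    have "ec_R3 L R = 2 * a * m * y - k * (be * By - Qy * (y / W) - Qz * (y / W))"
      by (simp add: ec_R3_def k_def flip: defs)
    then show ?thesis by (simp add: algebra_simps)
  qed
  have R4: "ec_R4 L R = 2 * a * m * z - k * be * Bz + k * (Qy + Qz) * (z / W)"
  proof -
    have "ec_R4 L R = 2 * a * m * z - k * (be * Bz - Qy * (z / W) - Qz * (z / W))"
      by (simp add: ec_R4_def k_def flip: defs)
    then show ?thesis by (simp add: algebra_simps)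
  qed
  have By': "jump (\<lambda>w. beta w * b_y w) L R = be * jBy + jb * By"
    and Bz': "jump (\<lambda>w. beta w * b_z w) L R = be * jBz + jb * Bz"
    unfolding jump_mult by (simp_all add: defs)
  have "jump rho L R * x + alpha0 G L R * jb * ec_F1 L R + jb * ec_R1 G L R + jx * ec_R2 L R
      + jy * ec_R3 L R + jz * ec_R4 L R + (be * jBy + jb * By) * ec_F7 L R + (be * jBz + jb * Bz) * ec_F8 L R
    = (avg rho L R * jx + jump rho L R * x)
      + a * (2 * m * (x * jx + y * jy + z * jz) - (x * jb + be * jx))
      + t * (Z * jb - jx)
      + (1/2 * By2 * (jb * x + be * jx) + 1/2 * Bz2 * (jb * x + be * jx))
      + k * (Qy + Qz) * ((x * jx + y * jy + z * jz) / W)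
      - k * (jb * (By * y) + be * By * jy) - k * (jb * (Bz * z) + be * Bz * jz)
      + (be * ec_F7 L R) * jBy + (be * ec_F8 L R) * jBz"
    unfolding R1 R2 R3 R4 by (simp add: algebra_simps add_divide_distrib)
  also have "\<dots> = (avg rho L R * jx + jump rho L R * x)
      + a * (2 * m * (W * j) - (x * jb + be * jx))
      + t * (Z * jb - jx)
      + (bu * (By * jBy) + 1/2 * By2 * (jb * x + be * jx))
      + (bu * (Bz * jBz) + 1/2 * Bz2 * (jb * x + be * jx))
      + k * (Qy * j - jb * (By * y) - be * By * jy - bv * jBy)
      + k * (Qz * j - jb * (Bz * z) - be * Bz * jz - bt * jBz)"
    unfolding J F7 F8 using pos by (simp add: algebra_simps)
  also have "avg rho L R * jx + jump rho L R * x = jump (\<lambda>w. rho w * u_x w) L R"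
    unfolding jump_mult defs ..
  also have "a * (2 * m * (W * j) - (x * jb + be * jx)) = jump (\<lambda>w. beta w * u_x w * (b_x w)\<^sup>2 / 2) L R
      - jump (\<lambda>w. beta w * u_x w * b_x w / lorentz w) L R * c"
    unfolding defs by (rule longitudinal_tension[OF L R])
  also have "t * (Z * jb - jx) = jump (\<lambda>w. beta w * b0 w) L R * avg (\<lambda>w. u_x w * b0 w) L R
      - jump (\<lambda>w. beta w * u_x w * (b0 w)\<^sup>2 / 2) L R"
    unfolding defs by (rule time_component[OF L R])
  also have "bu * (By * jBy) + 1/2 * By2 * (jb * x + be * jx) = jump (\<lambda>w. beta w * u_x w * (b_y w)\<^sup>2 / 2) L R"
    unfolding defs by (rule transverse_pressure)
  also have "bu * (Bz * jBz) + 1/2 * Bz2 * (jb * x + be * jx) = jump (\<lambda>w. beta w * u_x w * (b_z w)\<^sup>2 / 2) L R"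
    unfolding defs by (rule transverse_pressure)
  also have "Qy * j - jb * (By * y) - be * By * jy - bv * jBy
      = - W * jump (\<lambda>w. beta w * u_y w * b_y w / lorentz w) L R"
    unfolding defs by (rule transverse_tension[OF L R])
  also have "Qz * j - jb * (Bz * z) - be * Bz * jz - bt * jBz
      = - W * jump (\<lambda>w. beta w * u_z w * b_z w / lorentz w) L R"
    unfolding defs by (rule transverse_tension[OF L R])
  finally show ?thesis
    unfolding By' Bz' kW
    by (simp add: algebra_simps flip: defs)
qed

text \<open>
  The sixth flux component vanishes, so \<open>[[\<beta> b\<^sub>x]]\<close> does not contribute.  On the other side
  \<open>\<Phi> = \<beta> (u \<bullet> b) / W\<close> matches the three tension terms of \<open>residual_identity\<close>, and
  \<open>mean B\<^sub>1 = mean (W b\<^sub>x) - mean (u\<^sub>x b\<^sub>0)\<close> separates them from the terms in \<open>b\<^sub>0\<close>.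
\<close>

lemma ec_flux_entropy_identity:
  assumes G: "1 < G" and L: "admissible L" and R: "admissible R"
  shows "jump (entropy_vars G) L R \<bullet> ec_flux G L R =
    jump (psi1 G) L R - jump (\<lambda>w. Phi (entropy_vars G w)) L R * avg (\<lambda>w. mag w $ 1) L R"
proof -
  have lr: "log_mean rho L R \<noteq> 0"
    using L R by (intro log_mean_nonzero) (simp_all add: admissible_def)
  have "jump (entropy_vars G) L R \<bullet> ec_flux G L R =
      jump (entropy_vars G) L R $ 1 * ec_F1 L R
      + (jump (\<lambda>w. beta w * u_x w) L R * ec_F2 G L R + jump (\<lambda>w. beta w * u_y w) L R * ec_F3 G L R
        + jump (\<lambda>w. beta w * u_z w) L R * ec_F4 G L R - jump (\<lambda>w. beta w * lorentz w) L R * ec_F5 G L R)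
      + jump (\<lambda>w. beta w * b_y w) L R * ec_F7 L R + jump (\<lambda>w. beta w * b_z w) L R * ec_F8 L R"
    by (simp add: inner_vec_def sum_8 ec_flux_def vector_8)
       (simp add: jump_def entropy_vars_def vector_8 beta_def algebra_simps)
  also have "jump (entropy_vars G) L R $ 1 * ec_F1 L R =
      jump rho L R * avg u_x L R + alpha0 G L R * jump beta L R * ec_F1 L R"
    unfolding jump_V1[OF G L R] using lr by (simp add: ec_F1_def field_simps)
  finally have eq: "jump (entropy_vars G) L R \<bullet> ec_flux G L R =
      jump rho L R * avg u_x L R + alpha0 G L R * jump beta L R * ec_F1 L R
      + jump beta L R * ec_R1 G L R + jump u_x L R * ec_R2 L R + jump u_y L R * ec_R3 L R
      + jump u_z L R * ec_R4 L R
      + jump (\<lambda>w. beta w * b_y w) L R * ec_F7 L R + jump (\<lambda>w. beta w * b_z w) L R * ec_F8 L R"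
    unfolding momentum_energy_contribution[OF L R] by simp
  have psi: "jump (psi1 G) L R = jump (\<lambda>w. rho w * u_x w) L R
      + jump (\<lambda>w. beta w * u_x w * (b_x w)\<^sup>2 / 2) L R
      + jump (\<lambda>w. beta w * u_x w * (b_y w)\<^sup>2 / 2) L R + jump (\<lambda>w. beta w * u_x w * (b_z w)\<^sup>2 / 2) L R
      - jump (\<lambda>w. beta w * u_x w * (b0 w)\<^sup>2 / 2) L R"
    by (simp add: jump_def psi1_eq[OF G] L R inner_vec_def sum_3)
       (simp add: field_simps power2_eq_square)
  have b0: "beta w * b0 w = beta w * u_x w * b_x w / lorentz w + beta w * u_y w * b_y w / lorentz w
      + beta w * u_z w * b_z w / lorentz w" if "admissible w" for w
  proof -
    have "b0 w = (u_x w * b_x w + u_y w * b_y w + u_z w * b_z w) / lorentz w"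
      using uvec_inner_bvec[OF that] lorentz_pos[OF that]
      by (simp add: inner_vec_def sum_3 field_simps)
    then show ?thesis by (simp add: algebra_simps add_divide_distrib)
  qed
  have jPhi: "jump (\<lambda>w. Phi (entropy_vars G w)) L R = jump (\<lambda>w. beta w * b0 w) L R"
    by (simp add: jump_def Phi_entropy_vars L R)
  have jb0: "jump (\<lambda>w. beta w * b0 w) L R = jump (\<lambda>w. beta w * u_x w * b_x w / lorentz w) L R
        + jump (\<lambda>w. beta w * u_y w * b_y w / lorentz w) L R
        + jump (\<lambda>w. beta w * u_z w * b_z w / lorentz w) L R"
    unfolding jump_def b0[OF L] b0[OF R] by simp
  have aB: "avg (\<lambda>w. mag w $ 1) L R = avg (\<lambda>w. lorentz w * b_x w) L R - avg (\<lambda>w. u_x w * b0 w) L R"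
    by (simp add: avg_def mag_eq L R field_simps)
  show ?thesis
    unfolding eq residual_identity[OF L R] psi jPhi aB
    by (simp add: algebra_simps) (simp add: jb0 algebra_simps)
qed

theorem theorem3p1:
  fixes G :: real
  assumes "1 < G" and "G \<le> 2"
  shows "consistent_flux G (ec_flux G) \<and> entropy_conservative G (ec_flux G)"
proof -
  have "consistent_flux G (ec_flux G)"
    using ec_flux_diag[OF assms(1)] by (simp add: consistent_flux_def)
  then show ?thesis
    unfolding entropy_conservative_def
    using ec_flux_commute ec_flux_entropy_identity[OF assms(1)] by blast
qed

end
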